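(* For any $\{0,1\}$-valued stochastic process $(X_t)_{t\in\mathbb{N}}$, the following two conditions are equivalent: (i) $(X_t)$ is $k$-th order Markov (with respect to its natural filtration) for some $k\in\mathbb{N}$, and exchangeable. (ii) $(X_t)$ is either constant (as a function of time, i.e. almost surely $X_1=X_2=\cdots$) or i.i.d. Said differently, $\overline{\mathcal{Q}}\cap\mathcal{P}_k=\mathcal{Q}\cup\mathcal{C}$ for any $k\in\mathbb{N}$.
   Context: All laws are probability measures on the space $\{0,1\}^{\mathbb{N}}$ of infinite binary sequences $(X_t)_{t\ge 1}$, $\mathbb{N}=\{1,2,\dots\}$. A sequence is exchangeable if for every $t$ and every permutation $\sigma$ of $\{1,\dots,t\}$, $(X_1,\dots,X_t)$ has the same distribution as $(X_{\sigma(1)},\dots,X_{\sigma(t)})$. $\overline{\mathcal{Q}}$ is the set of all exchangeable laws. $\mathcal{Q}=\{\mathrm{Ber}(p)^\infty: p\in[0,1]\}$ is the set of laws of i.i.d. Bernoulli sequences. $\mathcal{P}_k$ is the set of laws of time-homogeneous $k$-th order Markov processes with values in $\{0,1\}$ (the conditional law of $X_t$, $t>k$, given $X_1,\dots,X_{t-1}$ depends only on $(X_{t-k},\dots,X_{t-1})$, through transition probabilities not depending on $t$; the law of the first $k$ values is arbitrary). $\mathcal{C}$ is the set of laws of constant sequences: $X_1\sim\mathrm{Ber}(p)$ for some $p\in[0,1]$ and $X_t=X_1$ for all $t>1$. *)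

theory Defs
  imports "HOL-Probability.Probability"
begin

text \<open>
  The state space \<open>{0,1}\<close> is \<^typ>\<open>bool\<close> with \<^term>\<open>True\<close> for 1, and time runs over \<open>{1..}\<close>;
  a process is a function \<open>X :: nat \<Rightarrow> 'a \<Rightarrow> bool\<close> whose value \<open>X 0\<close> is never used.
\<close>

definition seq_space :: "nat set \<Rightarrow> (nat \<Rightarrow> bool) measure" where
  "seq_space I = (\<Pi>\<^sub>M i\<in>I. count_space UNIV)"

definition binary_process :: "'a measure \<Rightarrow> (nat \<Rightarrow> 'a \<Rightarrow> bool) \<Rightarrow> bool" where
  "binary_process M X \<longleftrightarrow> prob_space M \<and> (\<forall>t\<ge>1. X t \<in> measurable M (count_space UNIV))"

definition exchangeable :: "'a measure \<Rightarrow> (nat \<Rightarrow> 'a \<Rightarrow> bool) \<Rightarrow> bool" where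
  "exchangeable M X \<longleftrightarrow>
     (\<forall>t\<ge>1. \<forall>\<sigma>. \<sigma> permutes {1..t} \<longrightarrow>
        distr M (seq_space {1..t}) (\<lambda>\<omega>. \<lambda>i\<in>{1..t}. X i \<omega>) =
        distr M (seq_space {1..t}) (\<lambda>\<omega>. \<lambda>i\<in>{1..t}. X (\<sigma> i) \<omega>))"

definition iid :: "'a measure \<Rightarrow> (nat \<Rightarrow> 'a \<Rightarrow> bool) \<Rightarrow> bool" where
  "iid M X \<longleftrightarrow>
     prob_space.indep_vars M (\<lambda>_. count_space UNIV) X {1..} \<and>
     (\<forall>t\<ge>1. distr M (count_space UNIV) (X t) = distr M (count_space UNIV) (X 1))"

definition constant_process :: "'a measure \<Rightarrow> (nat \<Rightarrow> 'a \<Rightarrow> bool) \<Rightarrow> bool" where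
  "constant_process M X \<longleftrightarrow> (AE \<omega> in M. \<forall>t\<ge>1. X t \<omega> = X 1 \<omega>)"

text \<open>The sigma-algebra on the sample space generated by \<open>X i\<close>, \<open>i \<in> I\<close>; only its measurable sets matter.\<close>

definition gen_sigma :: "'a measure \<Rightarrow> (nat \<Rightarrow> 'a \<Rightarrow> bool) \<Rightarrow> nat set \<Rightarrow> 'a measure" where
  "gen_sigma M X I = vimage_algebra (space M) (\<lambda>\<omega>. \<lambda>i\<in>I. X i \<omega>) (seq_space I)"

lemma subalgebra_gen_sigma:
  assumes "binary_process M X" and "I \<subseteq> {1..}"
  shows "subalgebra M (gen_sigma M X I)"
proof -
  have f: "(\<lambda>\<omega>. \<lambda>i\<in>I. X i \<omega>) \<in> measurable M (seq_space I)"
    unfolding seq_space_def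
    by (rule measurable_restrict) (use assms in \<open>auto simp: binary_process_def\<close>)
  then have "(\<lambda>\<omega>. \<lambda>i\<in>I. X i \<omega>) \<in> space M \<rightarrow> space (seq_space I)"
    by (auto dest: measurable_space)
  with f show ?thesis
    unfolding subalgebra_def gen_sigma_def
    by (auto simp: sets_vimage_algebra2 intro: measurable_sets)
qed

text \<open>A version of the conditional probability of \<open>X t = b\<close> given the \<open>X i\<close>, \<open>i \<in> I\<close>.\<close>

definition cond_prob_given ::
    "'a measure \<Rightarrow> (nat \<Rightarrow> 'a \<Rightarrow> bool) \<Rightarrow> nat set \<Rightarrow> nat \<Rightarrow> bool \<Rightarrow> 'a \<Rightarrow> real" where
  "cond_prob_given M X I t b =
     real_cond_exp M (gen_sigma M X I) (indicator {\<omega> \<in> space M. X t \<omega> = b})"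

text \<open>
  The Markov property of order \<open>k\<close> with respect to the natural filtration. Here the conditional law
  of \<open>X t\<close> given the last \<open>k\<close> values may depend on \<open>t\<close>; the homogeneous version below requires
  one transition kernel \<open>K\<close>, whose argument lists the last \<open>k\<close> values in chronological order.
\<close>

definition markov_of_order :: "nat \<Rightarrow> 'a measure \<Rightarrow> (nat \<Rightarrow> 'a \<Rightarrow> bool) \<Rightarrow> bool" where
  "markov_of_order k M X \<longleftrightarrow>
     (\<forall>t>k. \<forall>b. AE \<omega> in M.
        cond_prob_given M X {1..t - 1} t b \<omega> = cond_prob_given M X {t - k..t - 1} t b \<omega>)"

definition homogeneous_markov_of_order :: "nat \<Rightarrow> 'a measure \<Rightarrow> (nat \<Rightarrow> 'a \<Rightarrow> bool) \<Rightarrow> bool" where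
  "homogeneous_markov_of_order k M X \<longleftrightarrow>
     (\<exists>K :: bool list \<Rightarrow> bool pmf. \<forall>t>k. \<forall>b. AE \<omega> in M.
        cond_prob_given M X {1..t - 1} t b \<omega> = pmf (K (map (\<lambda>i. X i \<omega>) [t - k..<t])) b)"

text \<open>Laws on the space of infinite sequences, seen through the coordinate process.\<close>

definition coord :: "nat \<Rightarrow> (nat \<Rightarrow> bool) \<Rightarrow> bool" where
  "coord t x = x t"

definition laws :: "(nat \<Rightarrow> bool) measure set" where
  "laws = {P. prob_space P \<and> sets P = sets (seq_space {1..})}"

definition exchangeable_laws :: "(nat \<Rightarrow> bool) measure set" where
  "exchangeable_laws = {P \<in> laws. exchangeable P coord}"

definition markov_laws :: "nat \<Rightarrow> (nat \<Rightarrow> bool) measure set" where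
  "markov_laws k = {P \<in> laws. homogeneous_markov_of_order k P coord}"

definition iid_bernoulli_laws :: "(nat \<Rightarrow> bool) measure set" where
  "iid_bernoulli_laws = {(\<Pi>\<^sub>M i\<in>{1..}. measure_pmf (bernoulli_pmf p)) | p. p \<in> {0..1}}"

definition constant_laws :: "(nat \<Rightarrow> bool) measure set" where
  "constant_laws =
     {P \<in> laws. constant_process P coord \<and>
        (\<exists>p\<in>{0..1}. distr P (count_space UNIV) (coord 1) = measure_pmf (bernoulli_pmf p))}"

end

theory Submission
  imports Defs
begin

text \<open>
  For an exchangeable binary sequence the probability of a word with \<open>a\<close> ones and \<open>b\<close> zeros is a
  number \<open>\<psi> a b\<close>, and \<open>\<psi> a b = \<psi> (a + 1) b + \<psi> a (b + 1)\<close>. If \<open>\<psi> 1 1 = 0\<close> then only constant words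
  have positive probability. Otherwise every \<open>\<psi> a b\<close> is positive: no de Finetti representation is
  needed, since the sequence is infinite and the recursion can be iterated. Two words longer than
  \<open>k\<close> that differ only in the first letter have the same last \<open>k\<close> letters but different numbers of ones,
  so the Markov property forces the conditional probability of a further one to be independent of
  the past once the past is longer than \<open>k\<close>; it is then the same number for all lengths, and the
  recursion transports this back to short words. Hence \<open>\<psi> a b = p ^ a * (1 - p) ^ b\<close>.
\<close>

section \<open>Mixed moments\<close>

text \<open>For a mixture of coin tossings \<open>\<psi> a b\<close> is the integral of
  \<open>p ^ a * (1 - p) ^ b\<close> over the mixing measure. The assumptions record only what
  splitting a word by its next letter provides.\<close>

locale mixed_moments =
  fixes \<psi> :: "nat \<Rightarrow> nat \<Rightarrow> real"
  assumes nonneg: "0 \<le> \<psi> a b"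
    and split: "\<psi> a b = \<psi> (Suc a) b + \<psi> a (Suc b)"
    and total: "\<psi> 0 0 = 1"
begin

lemma mono_Suc: "\<psi> (Suc a) b \<le> \<psi> a b" "\<psi> a (Suc b) \<le> \<psi> a b"
  using split[of a b] nonneg[of "Suc a" b] nonneg[of a "Suc b"] by auto

lemma mono: "a \<le> a' \<Longrightarrow> b \<le> b' \<Longrightarrow> \<psi> a' b' \<le> \<psi> a b"
  using lift_Suc_antimono_le[of "\<lambda>a. \<psi> a b'" a a'] lift_Suc_antimono_le[of "\<psi> a" b b'] mono_Suc
  by (meson order_trans)

text \<open>Interchanging ones and zeros is a symmetry; it carries results on the first argument
  over to the second.\<close>

lemma swapped: "mixed_moments (\<lambda>a b. \<psi> b a)"
  by unfold_locales (rule nonneg, subst split, rule add.commute, rule total)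

text \<open>If the larger moment vanished, \<open>\<psi> (Suc a) (b + j)\<close> would not depend on
  \<open>j\<close>, and \<open>\<psi> a (b + j)\<close> would lose the same positive amount at every
  step, against nonnegativity.\<close>

lemma pos_Suc_left:
  assumes "0 < \<psi> (Suc a) b"
  shows "0 < \<psi> (Suc (Suc a)) b"
proof (rule ccontr)
  assume "\<not> 0 < \<psi> (Suc (Suc a)) b"
  \<comment> \<open>Monotonicity in the second argument spreads the zero to all
    \<open>b + j\<close>.\<close>
  then have zero: "\<psi> (Suc (Suc a)) (b + j) = 0" for j
  proof (induction j)
    case 0
    with nonneg[of "Suc (Suc a)" b] show ?case by simp
  next
    case (Suc j)
    with mono_Suc(2)[of "Suc (Suc a)" "b + j"] nonneg[of "Suc (Suc a)" "b + Suc j"] show ?case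
      by simp
  qed
  have const: "\<psi> (Suc a) (b + j) = \<psi> (Suc a) b" for j
  proof (induction j)
    case (Suc j)
    with zero[of j] split[of "Suc a" "b + j"] show ?case by simp
  qed simp
  txt \<open>Each use of the recursion now splits the same positive amount off \<open>\<psi> a b\<close>.\<close>
  have "\<psi> a b = real j * \<psi> (Suc a) b + \<psi> a (b + j)" for j
  proof (induction j)
    case (Suc j)
    with const[of j] split[of a "b + j"] show ?case by (simp add: algebra_simps)
  qed simp
  then have "real j * \<psi> (Suc a) b \<le> \<psi> a b" for j
    using nonneg[of a "b + j"] by (metis add.right_neutral add_left_mono)
  moreover obtain j where "\<psi> a b < real j * \<psi> (Suc a) b"
    using reals_Archimedean3[OF assms] by blast
  ultimately show False by (meson not_le)
qed

text \<open>Positivity moves along the entries \<open>\<psi> (Suc a) 1\<close> first, then in the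
  second argument by symmetry; entries with a zero argument follow by monotonicity.\<close>

lemma pos:
  assumes "0 < \<psi> 1 1"
  shows "0 < \<psi> a b"
proof -
  interpret sw: mixed_moments "\<lambda>a b. \<psi> b a" by (rule swapped)
  have row: "0 < \<psi> (Suc a) 1" for a
    using assms by (induction a) (auto dest: pos_Suc_left)
  have "0 < \<psi> (Suc a) (Suc b)"
    using row[of a] by (induction b) (auto dest: sw.pos_Suc_left)
  then show ?thesis
    using mono_Suc(1)[of a b] mono_Suc(2)[of "Suc a" b] by linarith
qed

text \<open>The hypothesis \<open>ratio\<close> is the cross-multiplied statement that a further one
  is as likely after \<open>Suc a\<close> ones and \<open>b\<close> zeros as after \<open>a\<close>
  ones and \<open>Suc b\<close> zeros. Beyond \<open>k\<close> this probability depends on the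
  length only; it turns out to be one constant, and the recursion produces the powers.\<close>

lemma product_form:
  assumes "\<psi> 1 1 > 0"
    and ratio: "\<And>a b. k \<le> a + b \<Longrightarrow>
      \<psi> (Suc a) (Suc b) * \<psi> (Suc a) b = \<psi> (Suc (Suc a)) b * \<psi> a (Suc b)"
  shows "\<psi> a b = \<psi> 1 0 ^ a * (1 - \<psi> 1 0) ^ b"
proof -
  define r where "r a b = \<psi> (Suc a) b / \<psi> a b" for a b
  note pos = pos[OF assms(1)]
  have ne: "\<psi> a b \<noteq> 0" for a b using pos[of a b] by simp
  have "r (Suc a) b = r a (Suc b)" if "k \<le> a + b" for a b
    using ratio[OF that] by (simp add: r_def divide_simps ne)
  \<comment> \<open>Ones are traded for zeros one at a time. Each trade starts from
    \<open>Suc a\<close>, which makes the bound on \<open>a + b\<close> strict.\<close>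
  then have "r a b = r 0 (a + b)" if "k < a + b" for a b
    using that by (induction a arbitrary: b) auto
  then have level: "\<psi> (Suc a) b = r 0 (a + b) * \<psi> a b" if "k < a + b" for a b
    using that by (metis r_def nonzero_eq_divide_eq ne)
  txt \<open>If the ratio is constant at level \<open>a + b = N\<close>, it is the same constant at all lower levels.\<close>
  have down: "\<forall>a b. a + b = N - m \<longrightarrow> \<psi> (Suc a) b = r 0 N * \<psi> a b" if "k < N" "m \<le> N" for m N
    using that(2)
  proof (induction m)
    case 0
    with level \<open>k < N\<close> show ?case by auto
  next
    case (Suc m)
    show ?case
    proof (intro allI impI)
      fix a b assume "a + b = N - Suc m"
      with Suc have "\<psi> (Suc (Suc a)) b = r 0 N * \<psi> (Suc a) b"
        and "\<psi> (Suc a) (Suc b) = r 0 N * \<psi> a (Suc b)" by auto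
      with split[of "Suc a" b] split[of a b] show "\<psi> (Suc a) b = r 0 N * \<psi> a b"
        by (simp add: algebra_simps)
    qed
  qed
  \<comment> \<open>At level 0 \<open>down\<close> reads
    \<open>\<psi> 1 0 = r 0 N * \<psi> 0 0\<close>, so all constants \<open>r 0 N\<close>
    agree.\<close>
  have p: "r 0 N = \<psi> 1 0" if "k < N" for N
    using down[OF that, of N] total by simp
  \<comment> \<open>The level \<open>Suc k + a + b\<close> lies beyond \<open>k\<close>; descending
    \<open>Suc k\<close> levels reaches \<open>a + b\<close>.\<close>
  have step: "\<psi> (Suc a) b = \<psi> 1 0 * \<psi> a b" for a b
    using down[of "Suc k + a + b" "Suc k"] p[of "Suc k + a + b"] by auto
  have "\<psi> 0 b = (1 - \<psi> 1 0) ^ b" for b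
  proof (induction b)
    case (Suc b)
    with step[of 0 b] split[of 0 b] show ?case by (simp add: algebra_simps)
  qed (simp add: total)
  then show ?thesis
  proof (induction a)
    case (Suc a)
    then show ?case by (subst step) simp
  qed simp
qed

end

section \<open>Word probabilities and exchangeability\<close>

text \<open>A word is a total function of which only the values on \<open>I\<close> matter, so one
  \<open>w\<close> can serve for its prefixes and windows.\<close>

definition cyl :: "'a measure \<Rightarrow> (nat \<Rightarrow> 'a \<Rightarrow> bool) \<Rightarrow> nat set \<Rightarrow> (nat \<Rightarrow> bool) \<Rightarrow> 'a set" where
  "cyl M X I w = {\<omega> \<in> space M. \<forall>i\<in>I. X i \<omega> = w i}"

lemma cyl_cong: "(\<And>i. i \<in> I \<Longrightarrow> v i = w i) \<Longrightarrow> cyl M X I v = cyl M X I w"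
  by (auto simp: cyl_def)

lemma seq_space_finite: "finite I \<Longrightarrow> seq_space I = count_space (PiE I (\<lambda>_. UNIV))"
  unfolding seq_space_def by (rule count_space_PiM_finite) auto

text \<open>Over a finite index set the sequence space is countable and discrete, so a law is
  determined by its atoms; the preimage of an atom is a cylinder.\<close>

lemma (in prob_space) distr_seq_space_eq_iff:
  assumes "finite I"
    and Y: "\<And>i. i \<in> I \<Longrightarrow> Y i \<in> measurable M (count_space UNIV)"
    and Z: "\<And>i. i \<in> I \<Longrightarrow> Z i \<in> measurable M (count_space UNIV)"
  shows "distr M (seq_space I) (\<lambda>\<omega>. \<lambda>i\<in>I. Y i \<omega>) = distr M (seq_space I) (\<lambda>\<omega>. \<lambda>i\<in>I. Z i \<omega>)
    \<longleftrightarrow> (\<forall>w. prob (cyl M Y I w) = prob (cyl M Z I w))" (is "?Y = ?Z \<longleftrightarrow> _")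
proof -
  have single: "emeasure (distr M (seq_space I) (\<lambda>\<omega>. \<lambda>i\<in>I. V i \<omega>)) {restrict w I}
      = ennreal (prob (cyl M V I w))"
    if V: "\<And>i. i \<in> I \<Longrightarrow> V i \<in> measurable M (count_space UNIV)" for V w
  proof -
    have "(\<lambda>\<omega>. \<lambda>i\<in>I. V i \<omega>) \<in> measurable M (seq_space I)"
      unfolding seq_space_def by (rule measurable_restrict) (rule V)
    moreover have "(\<lambda>\<omega>. \<lambda>i\<in>I. V i \<omega>) -` {restrict w I} \<inter> space M = cyl M V I w"
      by (auto simp: cyl_def fun_eq_iff restrict_def)
    ultimately show ?thesis
      using \<open>finite I\<close> by (subst emeasure_distr) (auto simp: seq_space_finite emeasure_eq_measure)
  qed
  show ?thesis
  proof
    assume "?Y = ?Z"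
    then have "emeasure ?Y {restrict w I} = emeasure ?Z {restrict w I}" for w by simp
    then show "\<forall>w. prob (cyl M Y I w) = prob (cyl M Z I w)"
      by (simp add: single Y Z)
  next
    assume eq: "\<forall>w. prob (cyl M Y I w) = prob (cyl M Z I w)"
    show "?Y = ?Z"
    proof (rule measure_eqI_countable)
      show "sets ?Y = Pow (PiE I (\<lambda>_. UNIV))" "sets ?Z = Pow (PiE I (\<lambda>_. UNIV))"
        using \<open>finite I\<close> by (simp_all add: seq_space_finite)
      show "countable (PiE I (\<lambda>_. UNIV) :: (nat \<Rightarrow> bool) set)"
        using \<open>finite I\<close> by (intro countable_PiE) auto
      fix x :: "nat \<Rightarrow> bool" assume "x \<in> PiE I (\<lambda>_. UNIV)"
      then have "x = restrict x I" by (simp add: PiE_def extensional_restrict)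
      with eq single[of Y x] single[of Z x] Y Z show "emeasure ?Y {x} = emeasure ?Z {x}"
        by simp
    qed
  qed
qed

text \<open>Equal numbers of \<open>True\<close> on a finite set mean equal multisets of values, and
  these differ by a permutation.\<close>

lemma permutation_with_count:
  assumes "finite A" "card {i \<in> A. v i} = card {i \<in> A. w i}"
  obtains \<sigma> where "\<sigma> permutes A" "\<And>i. i \<in> A \<Longrightarrow> v i = w (\<sigma> i)"
proof -
  have neg: "card {i \<in> A. \<not> u i} = card A - card {i \<in> A. u i}" for u :: "'a \<Rightarrow> bool"
  proof -
    have "{i \<in> A. \<not> u i} = A - {i \<in> A. u i}" by blast
    then show ?thesis using assms(1) by (simp add: card_Diff_subset)
  qed
  have "image_mset v (mset_set A) = image_mset w (mset_set A)"
  proof (rule multiset_eqI)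
    fix b :: bool
    have "count (image_mset u (mset_set A)) b = card {i \<in> A. u i = b}" for u
      using assms(1) by (simp add: count_image_mset' eq_commute[of b])
    with assms(2) neg[of v] neg[of w]
    show "count (image_mset v (mset_set A)) b = count (image_mset w (mset_set A)) b"
      by (cases b) auto
  qed
  then show thesis
    using image_mset_eq_implies_permutes[OF assms(1)] that by metis
qed

section \<open>Exchangeability in terms of word probabilities\<close>

locale binary_sequence = prob_space +
  fixes X :: "nat \<Rightarrow> 'a \<Rightarrow> bool"
  assumes meas: "1 \<le> t \<Longrightarrow> X t \<in> measurable M (count_space UNIV)"
begin

lemma event_coord [measurable]: "1 \<le> t \<Longrightarrow> {\<omega> \<in> space M. X t \<omega> = b} \<in> events"
  using measurable_sets[OF meas[of t], of "{b}"] by (simp add: vimage_def Int_def conj_commute)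

lemma event_cyl [measurable]: "finite I \<Longrightarrow> I \<subseteq> {1..} \<Longrightarrow> cyl M X I w \<in> events"
  unfolding cyl_def by (rule sets.sets_Collect_finite_All) auto

abbreviation wp :: "nat \<Rightarrow> (nat \<Rightarrow> bool) \<Rightarrow> real" where
  "wp n w \<equiv> prob (cyl M X {1..n} w)"

text \<open>Since \<open>\<sigma>\<close> maps \<open>{1..t}\<close> onto itself, the permuted
  process spells \<open>w \<circ> \<sigma>\<close> exactly when \<open>X\<close> spells
  \<open>w\<close>.\<close>

lemma exchangeable_iff:
  "exchangeable M X \<longleftrightarrow> (\<forall>t\<ge>1. \<forall>\<sigma>. \<sigma> permutes {1..t} \<longrightarrow> (\<forall>w. wp t (w \<circ> \<sigma>) = wp t w))"
proof -
  have "distr M (seq_space {1..t}) (\<lambda>\<omega>. \<lambda>i\<in>{1..t}. X i \<omega>) =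
        distr M (seq_space {1..t}) (\<lambda>\<omega>. \<lambda>i\<in>{1..t}. X (\<sigma> i) \<omega>)
      \<longleftrightarrow> (\<forall>w. wp t (w \<circ> \<sigma>) = wp t w)" if \<sigma>: "\<sigma> permutes {1..t}" for t \<sigma>
  proof -
    have mem: "\<sigma> i \<in> {1..t} \<longleftrightarrow> i \<in> {1..t}" for i
      using \<sigma> by (rule permutes_in_image)
    have "cyl M (\<lambda>i. X (\<sigma> i)) {1..t} (w \<circ> \<sigma>) = cyl M X {1..t} w" for w
    proof -
      have "(\<forall>i\<in>{1..t}. X (\<sigma> i) \<omega> = w (\<sigma> i)) \<longleftrightarrow> (\<forall>j\<in>\<sigma> ` {1..t}. X j \<omega> = w j)" for \<omega>
        by blast
      then show ?thesis
        unfolding cyl_def permutes_image[OF \<sigma>] by simp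
    qed
    \<comment> \<open>Every word has the form \<open>v \<circ> \<sigma>\<close>, so the quantifier
      over words can be reindexed.\<close>
    moreover have "w = (w \<circ> inv \<sigma>) \<circ> \<sigma>" for w :: "nat \<Rightarrow> bool"
      using permutes_inv_o(2)[OF \<sigma>] by (simp add: comp_assoc)
    ultimately have "(\<forall>w. wp t w = prob (cyl M (\<lambda>i. X (\<sigma> i)) {1..t} w))
        \<longleftrightarrow> (\<forall>w. wp t (w \<circ> \<sigma>) = wp t w)" by metis
    moreover have "X (\<sigma> i) \<in> measurable M (count_space UNIV)" if "i \<in> {1..t}" for i
      using that mem[of i] by (intro meas) auto
    ultimately show ?thesis
      by (subst distr_seq_space_eq_iff) (auto intro: meas)
  qed
  then show ?thesis unfolding exchangeable_def by blast
qed

lemma wp_split: "wp n w = wp (Suc n) (w(Suc n := True)) + wp (Suc n) (w(Suc n := False))"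
proof -
  have "cyl M X {1..n} w =
      cyl M X {1..Suc n} (w(Suc n := True)) \<union> cyl M X {1..Suc n} (w(Suc n := False))"
    by (auto simp: cyl_def atLeastAtMostSuc_conv)
  moreover have "cyl M X {1..Suc n} (w(Suc n := True)) \<inter> cyl M X {1..Suc n} (w(Suc n := False)) = {}"
    by (force simp: cyl_def)
  ultimately show ?thesis
    by (simp add: finite_measure_Union)
qed

text \<open>The transposition of 1 and \<open>t\<close> preserves the joint law; projecting to the
  first coordinate compares the two marginals.\<close>

lemma ident_distrib_if_exchangeable:
  assumes "exchangeable M X" "1 \<le> t"
  shows "distr M (count_space UNIV) (X t) = distr M (count_space UNIV) (X 1)"
proof -
  let ?\<sigma> = "Transposition.transpose 1 t"
  have \<sigma>: "?\<sigma> permutes {1..t}" using \<open>1 \<le> t\<close> by (intro permutes_swap_id) auto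
  have X: "X (?\<sigma> i) \<in> measurable M (count_space UNIV)" if "i \<in> {1..t}" for i
    using that permutes_in_image[OF \<sigma>, of i] by (intro meas) auto
  have first: "distr (distr M (seq_space {1..t}) (\<lambda>\<omega>. \<lambda>i\<in>{1..t}. Y i \<omega>)) (count_space UNIV) (\<lambda>x. x 1)
      = distr M (count_space UNIV) (Y 1)"
    if "\<And>i. i \<in> {1..t} \<Longrightarrow> Y i \<in> measurable M (count_space UNIV)" for Y :: "nat \<Rightarrow> 'a \<Rightarrow> bool"
  proof (subst distr_distr)
    show "(\<lambda>x. x 1) \<in> measurable (seq_space {1..t}) (count_space UNIV)"
      unfolding seq_space_def using \<open>1 \<le> t\<close> by (intro measurable_component_singleton) auto
    show "(\<lambda>\<omega>. \<lambda>i\<in>{1..t}. Y i \<omega>) \<in> measurable M (seq_space {1..t})"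
      unfolding seq_space_def by (intro measurable_restrict that)
    show "distr M (count_space UNIV) ((\<lambda>x. x 1) \<circ> (\<lambda>\<omega>. \<lambda>i\<in>{1..t}. Y i \<omega>))
        = distr M (count_space UNIV) (Y 1)"
      using \<open>1 \<le> t\<close> by (intro distr_cong) auto
  qed
  have "distr M (seq_space {1..t}) (\<lambda>\<omega>. \<lambda>i\<in>{1..t}. X i \<omega>) =
        distr M (seq_space {1..t}) (\<lambda>\<omega>. \<lambda>i\<in>{1..t}. X (?\<sigma> i) \<omega>)"
    using assms \<sigma> unfolding exchangeable_def by blast
  with first[of X] first[of "\<lambda>i. X (?\<sigma> i)"] X show ?thesis
    by (simp add: meas)
qed

section \<open>Marginals, and independence in terms of words\<close>

lemma prob_eq_if_distr_eq:
  assumes "distr M (count_space UNIV) (X s) = distr M (count_space UNIV) (X t)" "1 \<le> s" "1 \<le> t"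
  shows "prob {\<omega> \<in> space M. X s \<omega> = b} = prob {\<omega> \<in> space M. X t \<omega> = b}"
proof -
  have "measure (distr M (count_space UNIV) (X s)) {b} = measure (distr M (count_space UNIV) (X t)) {b}"
    using assms(1) by (rule arg_cong)
  then show ?thesis
    using assms(2,3) by (simp add: measure_distr meas vimage_def Int_def conj_commute)
qed

lemma prob_eq_pmf_bernoulli:
  assumes "1 \<le> t"
  shows "prob {\<omega> \<in> space M. X t \<omega> = b} = pmf (bernoulli_pmf (prob {\<omega> \<in> space M. X t \<omega> = True})) b"
proof -
  have "prob {\<omega> \<in> space M. X t \<omega> = False} = 1 - prob {\<omega> \<in> space M. X t \<omega> = True}"
    using prob_compl[OF event_coord[OF assms, of True]] by (simp add: set_diff_eq cong: conj_cong)
  then show ?thesis by (cases b) auto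
qed

text \<open>For the converse, an event on a finite set \<open>J\<close> of times is padded to an
  initial segment and cut into words; the distributive law then turns the sum of products into a
  product of sums.\<close>

lemma indep_iff_words:
  "indep_vars (\<lambda>_. count_space UNIV) X {1..} \<longleftrightarrow>
    (\<forall>n w. wp n w = (\<Prod>i\<in>{1..n}. prob {\<omega> \<in> space M. X i \<omega> = w i}))"
proof
  assume indep: "indep_vars (\<lambda>_. count_space UNIV) X {1..}"
  show "\<forall>n w. wp n w = (\<Prod>i\<in>{1..n}. prob {\<omega> \<in> space M. X i \<omega> = w i})"
  proof (intro allI)
    fix n w
    show "wp n w = (\<Prod>i\<in>{1..n}. prob {\<omega> \<in> space M. X i \<omega> = w i})"
    proof (cases "n = 0")
      case True
      then show ?thesis by (simp add: cyl_def prob_space)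
    next
      case False
      then have "prob (\<Inter>i\<in>{1..n}. X i -` {w i} \<inter> space M) =
          (\<Prod>i\<in>{1..n}. prob (X i -` {w i} \<inter> space M))"
        by (intro indep_varsD[OF indep]) auto
      moreover have "(\<Inter>i\<in>{1..n}. X i -` {w i} \<inter> space M) = cyl M X {1..n} w"
        using False by (auto simp: cyl_def)
      moreover have "X i -` {w i} \<inter> space M = {\<omega> \<in> space M. X i \<omega> = w i}" for i by auto
      ultimately show ?thesis by simp
    qed
  qed
next
  assume words: "\<forall>n w. wp n w = (\<Prod>i\<in>{1..n}. prob {\<omega> \<in> space M. X i \<omega> = w i})"
  show "indep_vars (\<lambda>_. count_space UNIV) X {1..}"
    unfolding indep_vars_def2
  proof (intro conjI ballI indep_setsI)
    fix A :: "nat \<Rightarrow> 'a set" and J :: "nat set"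
    assume J: "J \<noteq> {}" "J \<subseteq> {1..}" "finite J"
      and "\<forall>j\<in>J. A j \<in> {X j -` B \<inter> space M |B. B \<in> sets (count_space UNIV)}"
    then have "\<forall>j\<in>J. \<exists>B. A j = X j -` B \<inter> space M" by blast
    then obtain B where B: "A j = X j -` B j \<inter> space M" if "j \<in> J" for j by metis
    define n where "n = Max J"
    \<comment> \<open>Times outside \<open>J\<close> carry no constraint.\<close>
    define C where "C j = (if j \<in> J then B j else UNIV)" for j
    have Jn: "J \<subseteq> {1..n}" using J by (auto simp: n_def)
    have fin: "finite (C i)" for i by (rule finite_subset[of _ UNIV]) auto
    have eq: "(\<Inter>j\<in>J. A j) = (\<Union>w\<in>PiE {1..n} C. cyl M X {1..n} w)"
    proof (intro equalityI subsetI)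
      fix \<omega> assume \<omega>: "\<omega> \<in> (\<Inter>j\<in>J. A j)"
      then have "X j \<omega> \<in> B j" if "j \<in> J" for j
        using that B[OF that] by auto
      then have "restrict (\<lambda>i. X i \<omega>) {1..n} \<in> PiE {1..n} C"
        by (auto simp: C_def)
      moreover have "\<omega> \<in> cyl M X {1..n} (restrict (\<lambda>i. X i \<omega>) {1..n})"
        using \<omega> J B by (auto simp: cyl_def)
      ultimately show "\<omega> \<in> (\<Union>w\<in>PiE {1..n} C. cyl M X {1..n} w)" by blast
    next
      fix \<omega> assume "\<omega> \<in> (\<Union>w\<in>PiE {1..n} C. cyl M X {1..n} w)"
      then obtain w where w: "w \<in> PiE {1..n} C" "\<omega> \<in> cyl M X {1..n} w" by blast
      have "\<omega> \<in> A j" if "j \<in> J" for j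
      proof -
        have "j \<in> {1..n}" using that Jn by blast
        with w have "w j \<in> C j" "X j \<omega> = w j" "\<omega> \<in> space M"
          unfolding cyl_def by blast+
        with that show ?thesis by (simp add: B C_def)
      qed
      then show "\<omega> \<in> (\<Inter>j\<in>J. A j)" by blast
    qed
    have marginal: "(\<Sum>b\<in>C i. prob {\<omega> \<in> space M. X i \<omega> = b}) = prob (X i -` C i \<inter> space M)"
      if "i \<in> {1..n}" for i
    proof -
      have "X i -` C i \<inter> space M = (\<Union>b\<in>C i. {\<omega> \<in> space M. X i \<omega> = b})" by auto
      then show ?thesis
        using that fin by (subst finite_measure_finite_Union[symmetric]) (auto simp: disjoint_family_on_def)
    qed
    have "prob (\<Inter>j\<in>J. A j) = (\<Sum>w\<in>PiE {1..n} C. wp n w)"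
      unfolding eq
    proof (rule finite_measure_finite_Union)
      show "finite (PiE {1..n} C)" using fin by (intro finite_PiE) auto
      show "(\<lambda>w. cyl M X {1..n} w) ` PiE {1..n} C \<subseteq> events" by auto
      show "disjoint_family_on (\<lambda>w. cyl M X {1..n} w) (PiE {1..n} C)"
        unfolding disjoint_family_on_def
      proof (intro ballI impI equals0I)
        fix v w \<omega> assume PiE: "v \<in> PiE {1..n} C" "w \<in> PiE {1..n} C" and "v \<noteq> w"
          and \<omega>: "\<omega> \<in> cyl M X {1..n} v \<inter> cyl M X {1..n} w"
        have "v i = w i" if "i \<in> {1..n}" for i
          using that \<omega> by (auto simp: cyl_def)
        with PiE have "v = w" by (rule PiE_ext)
        with \<open>v \<noteq> w\<close> show False by contradiction
      qed
    qed
    also have "\<dots> = (\<Sum>w\<in>PiE {1..n} C. \<Prod>i\<in>{1..n}. prob {\<omega> \<in> space M. X i \<omega> = w i})"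
      by (rule sum.cong) (simp_all only: words)
    also have "\<dots> = (\<Prod>i\<in>{1..n}. \<Sum>b\<in>C i. prob {\<omega> \<in> space M. X i \<omega> = b})"
      by (rule prod_sum_PiE[symmetric]) (auto intro: fin)
    also have "\<dots> = (\<Prod>i\<in>{1..n}. prob (X i -` C i \<inter> space M))"
      by (rule prod.cong) (auto simp: marginal)
    \<comment> \<open>The padded times contribute the factor 1.\<close>
    also have "\<dots> = (\<Prod>j\<in>J. prob (A j))"
      using Jn by (intro prod.mono_neutral_cong_right) (auto simp: C_def B prob_space)
    finally show "prob (\<Inter>j\<in>J. A j) = (\<Prod>j\<in>J. prob (A j))" .
  next
    fix i :: nat assume "i \<in> {1..}"
    then show "{X i -` A \<inter> space M |A. A \<in> sets (count_space UNIV)} \<subseteq> events"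
      using measurable_sets[OF meas, of i] by auto
  qed (auto intro: meas)
qed

section \<open>I.i.d. and constant sequences are exchangeable\<close>

lemma exchangeable_if_iid:
  assumes "iid M X"
  shows "exchangeable M X"
  unfolding exchangeable_iff
proof (intro allI impI)
  fix t :: nat and \<sigma> w assume \<sigma>: "\<sigma> permutes {1..t}"
  have word: "wp t w = (\<Prod>i\<in>{1..t}. prob {\<omega> \<in> space M. X 1 \<omega> = w i})" for w
  proof -
    have "prob {\<omega> \<in> space M. X i \<omega> = b} = prob {\<omega> \<in> space M. X 1 \<omega> = b}" if "1 \<le> i" for i b
      using assms that unfolding iid_def by (intro prob_eq_if_distr_eq) blast+
    then have "prob {\<omega> \<in> space M. X i \<omega> = w i} = prob {\<omega> \<in> space M. X 1 \<omega> = w i}"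
      if "i \<in> {1..t}" for i using that atLeastAtMost_iff by blast
    moreover have "wp t w = (\<Prod>i\<in>{1..t}. prob {\<omega> \<in> space M. X i \<omega> = w i})"
      using assms indep_iff_words unfolding iid_def by blast
    ultimately show ?thesis by simp
  qed
  \<comment> \<open>All factors come from the law of \<open>X 1\<close>, so permuting the positions
    only reorders the product.\<close>
  show "wp t (w \<circ> \<sigma>) = wp t w"
    unfolding word by (subst (2) prod.permute[OF \<sigma>]) (simp add: comp_def)
qed

text \<open>The original and the permuted vector agree almost surely, hence in law.\<close>

lemma exchangeable_if_constant:
  assumes "constant_process M X"
  shows "exchangeable M X"
  unfolding exchangeable_def
proof (intro allI impI)
  fix t :: nat and \<sigma> assume "\<sigma> permutes {1..t}"
  then have ge: "1 \<le> \<sigma> i" if "i \<in> {1..t}" for i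
    using that permutes_in_image[of \<sigma> "{1..t}" i] by simp
  have "AE \<omega> in M. \<forall>i\<ge>1. X i \<omega> = X 1 \<omega>"
    using assms by (simp add: constant_process_def)
  then have "AE \<omega> in M. (\<lambda>i\<in>{1..t}. X i \<omega>) = (\<lambda>i\<in>{1..t}. X (\<sigma> i) \<omega>)"
  proof eventually_elim
    case (elim \<omega>)
    have "X i \<omega> = X (\<sigma> i) \<omega>" if "i \<in> {1..t}" for i
      using elim[rule_format, of i] elim[rule_format, of "\<sigma> i"] ge[OF that] that by simp
    then show ?case by (intro restrict_ext) auto
  qed
  then show "distr M (seq_space {1..t}) (\<lambda>\<omega>. \<lambda>i\<in>{1..t}. X i \<omega>) =
      distr M (seq_space {1..t}) (\<lambda>\<omega>. \<lambda>i\<in>{1..t}. X (\<sigma> i) \<omega>)"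
    by (intro distr_cong_AE) (auto simp: seq_space_def intro!: measurable_restrict meas ge)
qed

section \<open>The Markov property\<close>

text \<open>
  A form of the Markov property without division or conditional expectation, implied both by the
  homogeneous and by the inhomogeneous version: \<open>c\<close> is the transition probability into the last
  letter of \<open>u\<close>, and may depend on \<open>t\<close>.
\<close>

definition word_markov :: "nat \<Rightarrow> bool" where
  "word_markov k \<longleftrightarrow> (\<forall>t>k. \<forall>u. \<exists>c. \<forall>w.
     (\<forall>i\<in>{t - k..t}. w i = u i) \<longrightarrow> wp t w = c * wp (t - 1) w)"

section \<open>From conditional probabilities to word probabilities\<close>

lemma cyl_eq_vimage: "cyl M X I w = (\<lambda>\<omega>. \<lambda>i\<in>I. X i \<omega>) -` {restrict w I} \<inter> space M"
  by (auto simp: cyl_def fun_eq_iff restrict_def)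

lemma cyl_in_gen_sigma: "finite I \<Longrightarrow> cyl M X I w \<in> sets (gen_sigma M X I)"
  unfolding cyl_eq_vimage gen_sigma_def
  by (intro in_vimage_algebra) (auto simp: seq_space_finite)

text \<open>An instance of the Doob-Dynkin principle: the level set of \<open>f\<close> through
  \<open>\<omega>\<close> is the preimage of a set of words, so it cannot separate points with the
  same word.\<close>

lemma gen_sigma_const:
  assumes f: "f \<in> borel_measurable (gen_sigma M X I)"
    and "\<omega> \<in> space M" "\<omega>' \<in> space M" "\<And>i. i \<in> I \<Longrightarrow> X i \<omega> = X i \<omega>'"
  shows "f \<omega> = (f \<omega>' :: real)"
proof -
  have sp: "space (gen_sigma M X I) = space M" by (simp add: gen_sigma_def)
  have "f -` {f \<omega>} \<inter> space M \<in> sets (gen_sigma M X I)"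
    using measurable_sets[OF f, of "{f \<omega>}"] by (simp add: sp)
  moreover have "(\<lambda>\<omega>. \<lambda>i\<in>I. X i \<omega>) \<in> space M \<rightarrow> space (seq_space I)"
    by (auto simp: seq_space_def space_PiM)
  ultimately obtain A where A: "f -` {f \<omega>} \<inter> space M = (\<lambda>\<omega>. \<lambda>i\<in>I. X i \<omega>) -` A \<inter> space M"
    unfolding gen_sigma_def by (auto simp: sets_vimage_algebra2)
  have "(\<lambda>i\<in>I. X i \<omega>) = (\<lambda>i\<in>I. X i \<omega>')" using assms(4) by (intro restrict_ext) auto
  with A assms(2,3) show ?thesis by (metis (mono_tags, lifting) Int_iff singletonI singletonD vimage_eq)
qed

lemma gen_sigma_subalgebra: "I \<subseteq> {1..} \<Longrightarrow> finite_measure_subalgebra M (gen_sigma M X I)"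
  unfolding finite_measure_subalgebra_def finite_measure_subalgebra_axioms_def
  by (intro conjI finite_measure_axioms subalgebra_gen_sigma)
     (auto simp: binary_process_def prob_space_axioms meas)

text \<open>The cylinder of the past lies in the conditioning sigma-algebra, so the event and its
  conditional probability have the same integral over it. On a null cylinder both sides are 0,
  whatever \<open>c\<close> is.\<close>

lemma wp_eq_cond_prob:
  assumes "1 \<le> t"
    and AE: "AE \<omega> in M. \<omega> \<in> cyl M X {1..t - 1} w \<longrightarrow>
      cond_prob_given M X {1..t - 1} t (w t) \<omega> = c"
  shows "wp t w = c * wp (t - 1) w"
proof -
  let ?A = "cyl M X {1..t - 1} w" and ?f = "indicat_real {\<omega> \<in> space M. X t \<omega> = w t}"
  interpret F: finite_measure_subalgebra M "gen_sigma M X {1..t - 1}"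
    by (rule gen_sigma_subalgebra) auto
  have [measurable]: "?A \<in> events" "{\<omega> \<in> space M. X t \<omega> = w t} \<in> events"
    using \<open>1 \<le> t\<close> by auto
  have "cyl M X {1..t} w = ?A \<inter> {\<omega> \<in> space M. X t \<omega> = w t}"
  proof -
    have "{1..t} = insert t {1..t - 1}" using \<open>1 \<le> t\<close> by auto
    then show ?thesis by (auto simp: cyl_def)
  qed
  then have "wp t w = (LINT \<omega>:?A|M. ?f \<omega>)"
    by (simp add: set_lebesgue_integral_def indicator_inter_arith[symmetric])
  also have "\<dots> = (LINT \<omega>:?A|M. cond_prob_given M X {1..t - 1} t (w t) \<omega>)"
    unfolding cond_prob_given_def
    by (intro F.real_cond_exp_intA cyl_in_gen_sigma) (auto simp: emeasure_eq_measure)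
  also have "\<dots> = (LINT \<omega>:?A|M. c)"
    using AE by (intro set_lebesgue_integral_cong_AE) (auto simp: cond_prob_given_def)
  also have "\<dots> = c * wp (t - 1) w"
    by (simp add: set_lebesgue_integral_def)
  finally show ?thesis .
qed

text \<open>The constant is the value of the conditional probability on the window cylinder, where
  it cannot vary by \<open>gen_sigma_const\<close>.\<close>

lemma word_markov_if_markov:
  assumes "markov_of_order k M X"
  shows "word_markov k"
  unfolding word_markov_def
proof (intro allI impI)
  fix t and u :: "nat \<Rightarrow> bool" assume "k < t"
  define g where "g = cond_prob_given M X {t - k..t - 1} t (u t)"
  have "g \<in> borel_measurable (gen_sigma M X {t - k..t - 1})"
    by (simp add: g_def cond_prob_given_def)
  then have "g \<omega> = g \<omega>'" if "\<omega> \<in> cyl M X {t - k..t - 1} u" "\<omega>' \<in> cyl M X {t - k..t - 1} u" for \<omega> \<omega>'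
    using that by (intro gen_sigma_const) (auto simp: cyl_def)
  \<comment> \<open>If the window cylinder is empty, any \<open>c\<close> will do.\<close>
  then have "\<exists>c. \<forall>\<omega>\<in>cyl M X {t - k..t - 1} u. g \<omega> = c" by blast
  then obtain c where c: "\<And>\<omega>. \<omega> \<in> cyl M X {t - k..t - 1} u \<Longrightarrow> g \<omega> = c" by blast
  have "wp t w = c * wp (t - 1) w" if w: "\<forall>i\<in>{t - k..t}. w i = u i" for w
  proof (rule wp_eq_cond_prob)
    have "cyl M X {1..t - 1} w \<subseteq> cyl M X {t - k..t - 1} u"
      using w \<open>k < t\<close> by (auto simp: cyl_def)
    moreover have "w t = u t" using w by auto
    moreover have "AE \<omega> in M. cond_prob_given M X {1..t - 1} t (u t) \<omega> = g \<omega>"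
      using assms \<open>k < t\<close> unfolding markov_of_order_def g_def by blast
    ultimately show "AE \<omega> in M. \<omega> \<in> cyl M X {1..t - 1} w \<longrightarrow>
        cond_prob_given M X {1..t - 1} t (w t) \<omega> = c"
      using c by auto
  qed (use \<open>k < t\<close> in auto)
  then show "\<exists>c. \<forall>w. (\<forall>i\<in>{t - k..t}. w i = u i) \<longrightarrow> wp t w = c * wp (t - 1) w" by blast
qed

text \<open>The constant is the kernel evaluated at the window of \<open>u\<close>, since on the
  cylinder of the past the last \<open>k\<close> observed letters are those of
  \<open>u\<close>.\<close>

lemma word_markov_if_homogeneous_markov:
  assumes "homogeneous_markov_of_order k M X"
  shows "word_markov k"
  unfolding word_markov_def
proof (intro allI impI)
  fix t and u :: "nat \<Rightarrow> bool" assume "k < t"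
  from assms obtain K :: "bool list \<Rightarrow> bool pmf" where K: "AE \<omega> in M.
      cond_prob_given M X {1..t - 1} t (u t) \<omega> = pmf (K (map (\<lambda>i. X i \<omega>) [t - k..<t])) (u t)"
    using \<open>k < t\<close> unfolding homogeneous_markov_of_order_def by blast
  have "wp t w = pmf (K (map u [t - k..<t])) (u t) * wp (t - 1) w"
    if w: "\<forall>i\<in>{t - k..t}. w i = u i" for w
  proof (rule wp_eq_cond_prob)
    have last: "map (\<lambda>i. X i \<omega>) [t - k..<t] = map u [t - k..<t]" if \<omega>: "\<omega> \<in> cyl M X {1..t - 1} w" for \<omega>
    proof (rule map_cong[OF refl])
      fix i assume "i \<in> set [t - k..<t]"
      then have "i \<in> {1..t - 1}" "i \<in> {t - k..t}" using \<open>k < t\<close> by auto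
      with \<omega> w show "X i \<omega> = u i" unfolding cyl_def by blast
    qed
    have wt: "w t = u t" using w by auto
    show "AE \<omega> in M. \<omega> \<in> cyl M X {1..t - 1} w \<longrightarrow>
        cond_prob_given M X {1..t - 1} t (w t) \<omega> = pmf (K (map u [t - k..<t])) (u t)"
      using K
    proof eventually_elim
      case (elim \<omega>)
      show ?case
      proof
        assume "\<omega> \<in> cyl M X {1..t - 1} w"
        from elim show "cond_prob_given M X {1..t - 1} t (w t) \<omega> = pmf (K (map u [t - k..<t])) (u t)"
          unfolding last[OF \<open>\<omega> \<in> cyl M X {1..t - 1} w\<close>] wt .
      qed
    qed
  qed (use \<open>k < t\<close> in auto)
  then show "\<exists>c. \<forall>w. (\<forall>i\<in>{t - k..t}. w i = u i) \<longrightarrow> wp t w = c * wp (t - 1) w" by blast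
qed

section \<open>Exchangeable Markov sequences\<close>

text \<open>The representative word spells \<open>a\<close> ones followed by \<open>b\<close>
  zeros.\<close>

definition moment :: "nat \<Rightarrow> nat \<Rightarrow> real" where
  "moment a b = wp (a + b) (\<lambda>i. i \<le> a)"

text \<open>Words of one length with equally many ones are rearrangements of each other. Length 0 is
  separate because exchangeability is stated for \<open>t \<ge> 1\<close>.\<close>

lemma wp_eq_moment:
  assumes "exchangeable M X" "n = a + b" "card {i \<in> {1..n}. w i} = a"
  shows "wp n w = moment a b"
proof (cases "n = 0")
  case True
  with assms(2) show ?thesis by (simp add: moment_def cyl_def)
next
  case False
  have "{i \<in> {1..n}. i \<le> a} = {1..a}" using assms(2) by auto
  then have "card {i \<in> {1..n}. w i} = card {i \<in> {1..n}. i \<le> a}" using assms(3) by simp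
  then obtain \<sigma> where \<sigma>: "\<sigma> permutes {1..n}" "\<And>i. i \<in> {1..n} \<Longrightarrow> w i = (\<sigma> i \<le> a)"
    using permutation_with_count[of "{1..n}" w "\<lambda>i. i \<le> a"] by blast
  then have "wp n w = wp n ((\<lambda>i. i \<le> a) \<circ> \<sigma>)" by (subst cyl_cong[of _ w]) auto
  also have "\<dots> = wp n (\<lambda>i. i \<le> a)"
    using assms(1) False \<sigma>(1) unfolding exchangeable_iff by (meson less_one not_le)
  finally show ?thesis by (simp add: moment_def assms(2))
qed

text \<open>The recursion is \<open>wp_split\<close> for the representative word: the appended
  letter raises one of the two counts.\<close>

lemma mixed_moments_moment:
  assumes "exchangeable M X"
  shows "mixed_moments moment"
proof
  fix a b :: nat
  let ?w = "\<lambda>i. i \<le> a" and ?n = "a + b"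
  have "{i \<in> {1..Suc ?n}. (?w(Suc ?n := True)) i} = insert (Suc ?n) {1..a}"
    and "{i \<in> {1..Suc ?n}. (?w(Suc ?n := False)) i} = {1..a}" by auto
  then have "wp (Suc ?n) (?w(Suc ?n := True)) = moment (Suc a) b"
    and "wp (Suc ?n) (?w(Suc ?n := False)) = moment a (Suc b)"
    using wp_eq_moment[OF assms, of "Suc ?n" "Suc a" b "?w(Suc ?n := True)"]
      wp_eq_moment[OF assms, of "Suc ?n" a "Suc b" "?w(Suc ?n := False)"] by simp_all
  then show "moment a b = moment (Suc a) b + moment a (Suc b)"
    using wp_split[of ?n ?w] by (simp add: moment_def)
qed (simp_all add: moment_def cyl_def prob_space)

text \<open>Changing the first letter changes the counts but not the window, so both words pick up
  the same factor \<open>c\<close> at the next one; eliminating \<open>c\<close> leaves the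
  identity.\<close>

lemma moment_ratio:
  assumes ex: "exchangeable M X" and "word_markov k" "k \<le> a + b"
  shows "moment (Suc a) (Suc b) * moment (Suc a) b = moment (Suc (Suc a)) b * moment a (Suc b)"
proof -
  define n where "n = a + Suc b"
  txt \<open>Two words that differ only at time 1, which lies before the window of length \<open>k\<close>.\<close>
  define v w where "v i = (2 \<le> i \<and> i \<le> Suc a \<or> i = Suc n)"
    and "w i = (i \<le> Suc a \<or> i = Suc n)" for i
  have "k < Suc n" using assms(3) by (simp add: n_def)
  then obtain c where c: "\<And>u. \<forall>i\<in>{Suc n - k..Suc n}. u i = w i \<Longrightarrow> wp (Suc n) u = c * wp n u"
    using assms(2) unfolding word_markov_def by (metis diff_Suc_1)
  \<comment> \<open>As \<open>k \<le> a + b = n - 1\<close>, the window begins at time 2 or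
    later.\<close>
  have "\<forall>i\<in>{Suc n - k..Suc n}. v i = w i"
    using assms(3) by (auto simp: v_def w_def n_def)
  then have "wp (Suc n) v = c * wp n v" "wp (Suc n) w = c * wp n w"
    using c[of v] c[of w] by blast+
  moreover have "{i \<in> {1..n}. v i} = {2..Suc a}" "{i \<in> {1..n}. w i} = {1..Suc a}"
    "{i \<in> {1..Suc n}. v i} = insert (Suc n) {2..Suc a}"
    "{i \<in> {1..Suc n}. w i} = insert (Suc n) {1..Suc a}"
    by (auto simp: v_def w_def n_def)
  then have "wp n v = moment a (Suc b)" "wp n w = moment (Suc a) b"
    "wp (Suc n) v = moment (Suc a) (Suc b)" "wp (Suc n) w = moment (Suc (Suc a)) b"
    by (intro wp_eq_moment[OF ex]; simp add: n_def)+
  ultimately have "moment (Suc a) (Suc b) = c * moment a (Suc b)"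
    and "moment (Suc (Suc a)) b = c * moment (Suc a) b" by (metis, metis)
  then show ?thesis by simp
qed

text \<open>A word containing both letters has probability at most \<open>moment 1 1\<close>, and
  there are only countably many words of length \<open>t\<close>.\<close>

lemma constant_if_moment_zero:
  assumes ex: "exchangeable M X" and zero: "moment 1 1 = 0"
  shows "constant_process M X"
proof -
  interpret mixed_moments moment by (rule mixed_moments_moment) fact
  have "AE \<omega> in M. X t \<omega> = X 1 \<omega>" if "1 \<le> t" for t
  proof -
    \<comment> \<open>Comparing the letters at times 1 and \<open>t\<close> suffices; membership in
      \<open>PiE\<close> makes the set of words countable.\<close>
    let ?W = "{w :: nat \<Rightarrow> bool. w \<in> PiE {1..t} (\<lambda>_. UNIV) \<and> w t \<noteq> w 1}"
    have "AE \<omega> in M. \<omega> \<notin> cyl M X {1..t} w" if w: "w \<in> ?W" for w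
    proof -
      let ?a = "card {i \<in> {1..t}. w i}"
      have "1 \<in> {1..t}" "t \<in> {1..t}" "w t \<noteq> w 1" using w \<open>1 \<le> t\<close> by auto
      then have "{i \<in> {1..t}. w i} \<noteq> {}" "{i \<in> {1..t}. w i} \<subset> {1..t}" by blast+
      then have "0 < ?a" "?a < t"
        using psubset_card_mono[of "{1..t}" "{i \<in> {1..t}. w i}"] by (auto simp: card_gt_0_iff)
      then have "wp t w = moment ?a (t - ?a)" "1 \<le> ?a" "1 \<le> t - ?a"
        using wp_eq_moment[OF ex, of t ?a "t - ?a" w] by simp_all
      then have "wp t w = 0"
        using mono[of 1 ?a 1 "t - ?a"] zero nonneg[of ?a "t - ?a"] by simp
      then show ?thesis
        by (subst AE_iff_measurable[of "cyl M X {1..t} w"]) (auto simp: cyl_def emeasure_eq_measure)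
    qed
    moreover have "countable ?W"
      by (rule countable_subset[of _ "PiE {1..t} (\<lambda>_. UNIV)"]) (auto intro!: countable_PiE)
    ultimately have "AE \<omega> in M. \<forall>w\<in>?W. \<omega> \<notin> cyl M X {1..t} w"
      by (subst AE_ball_countable) blast+
    then show ?thesis
      using AE_space
    proof eventually_elim
      case (elim \<omega>)
      then have "\<omega> \<in> cyl M X {1..t} (\<lambda>i\<in>{1..t}. X i \<omega>)" by (simp add: cyl_def)
      with elim(1) have "(\<lambda>i\<in>{1..t}. X i \<omega>) \<notin> ?W" by blast
      with \<open>1 \<le> t\<close> show ?case by auto
    qed
  qed
  then show ?thesis
    unfolding constant_process_def by (simp add: AE_all_countable)
qed

text \<open>Grouping positions by letter rewrites the two powers as a product of marginals over all
  positions, which is independence by \<open>indep_iff_words\<close>.\<close>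

lemma iid_if_moment_product:
  assumes ex: "exchangeable M X"
    and product: "\<And>a b. moment a b = moment 1 0 ^ a * (1 - moment 1 0) ^ b"
  shows "iid M X"
proof -
  interpret mixed_moments moment by (rule mixed_moments_moment) fact
  let ?p = "\<lambda>b. if b then moment 1 0 else 1 - moment 1 0"
  have "wp 1 (\<lambda>_. b) = ?p b" for b
    using wp_eq_moment[OF ex, of 1 1 0 "\<lambda>_. True"] wp_eq_moment[OF ex, of 1 0 1 "\<lambda>_. False"]
      split[of 0 0] total by (cases b) auto
  then have first: "prob {\<omega> \<in> space M. X 1 \<omega> = b} = ?p b" for b
    by (simp add: cyl_def)
  have marginal: "prob {\<omega> \<in> space M. X i \<omega> = b} = ?p b" if "1 \<le> i" for i b
    using prob_eq_if_distr_eq[OF ident_distrib_if_exchangeable[OF ex that] that order_refl] first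
    by (rule trans)
  have "wp n w = (\<Prod>i\<in>{1..n}. prob {\<omega> \<in> space M. X i \<omega> = w i})" for n w
  proof -
    have "card {i \<in> {1..n}. w i} + card {i \<in> {1..n}. \<not> w i} = card ({i \<in> {1..n}. w i} \<union> {i \<in> {1..n}. \<not> w i})"
      by (rule card_Un_disjoint[symmetric]) auto
    also have "{i \<in> {1..n}. w i} \<union> {i \<in> {1..n}. \<not> w i} = {1..n}" by auto
    finally have "wp n w = moment (card {i \<in> {1..n}. w i}) (card {i \<in> {1..n}. \<not> w i})"
      by (intro wp_eq_moment[OF ex]) auto
    also have "\<dots> = (\<Prod>i\<in>{1..n}. ?p (w i))"
      by (subst product, subst prod.If_cases) (auto simp: Int_def)
    also have "\<dots> = (\<Prod>i\<in>{1..n}. prob {\<omega> \<in> space M. X i \<omega> = w i})"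
      by (rule prod.cong) (auto simp: marginal)
    finally show ?thesis .
  qed
  then have "indep_vars (\<lambda>_. count_space UNIV) X {1..}"
    unfolding indep_iff_words by blast
  then show ?thesis
    unfolding iid_def using ident_distrib_if_exchangeable[OF ex] by blast
qed

text \<open>The dichotomy is whether the word "one, zero" has probability 0.\<close>

lemma constant_or_iid:
  assumes ex: "exchangeable M X" and "word_markov k"
  shows "constant_process M X \<or> iid M X"
proof (cases "moment 1 1 = 0")
  case True
  with ex show ?thesis by (simp add: constant_if_moment_zero)
next
  case False
  interpret mixed_moments moment by (rule mixed_moments_moment) fact
  have "0 < moment 1 1" using False nonneg[of 1 1] by simp
  then have "moment a b = moment 1 0 ^ a * (1 - moment 1 0) ^ b" for a b
    using moment_ratio[OF assms] by (rule product_form)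
  then show ?thesis using iid_if_moment_product[OF ex] by blast
qed

section \<open>Constant and i.i.d. sequences are Markov\<close>

text \<open>The event \<open>X t = b\<close> agrees almost surely with \<open>X s = b\<close>, which
  is already measurable for the conditioning sigma-algebra and so is its own conditional
  expectation.\<close>

lemma cond_prob_if_constant:
  assumes "constant_process M X" "I \<subseteq> {1..}" "s \<in> I" "1 \<le> t"
  shows "AE \<omega> in M. cond_prob_given M X I t b \<omega> = indicator {\<omega> \<in> space M. X s \<omega> = b} \<omega>"
proof -
  interpret F: finite_measure_subalgebra M "gen_sigma M X I"
    using assms(2) by (rule gen_sigma_subalgebra)
  have [measurable]: "{\<omega> \<in> space M. X s \<omega> = b} \<in> events" "{\<omega> \<in> space M. X t \<omega> = b} \<in> events"
    using assms(2-4) by auto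
  have "{\<omega> \<in> space M. X s \<omega> = b} \<in> sets (gen_sigma M X I)"
  proof -
    define A where "A = (\<lambda>x. x s) -` {b} \<inter> space (seq_space I)"
    have "(\<lambda>x. x s) \<in> measurable (seq_space I) (count_space UNIV)"
      unfolding seq_space_def using assms(3) by (rule measurable_component_singleton)
    then have "A \<in> sets (seq_space I)"
      unfolding A_def by (rule measurable_sets) simp
    then have "(\<lambda>\<omega>. \<lambda>i\<in>I. X i \<omega>) -` A \<inter> space M \<in> sets (gen_sigma M X I)"
      unfolding gen_sigma_def by (rule in_vimage_algebra)
    moreover have "(\<lambda>i\<in>I. X i \<omega>) \<in> space (seq_space I)" for \<omega>
      by (auto simp: seq_space_def space_PiM)
    then have "(\<lambda>\<omega>. \<lambda>i\<in>I. X i \<omega>) -` A \<inter> space M = {\<omega> \<in> space M. (\<lambda>i\<in>I. X i \<omega>) s = b}"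
      unfolding A_def by blast
    then have "(\<lambda>\<omega>. \<lambda>i\<in>I. X i \<omega>) -` A \<inter> space M = {\<omega> \<in> space M. X s \<omega> = b}"
      using assms(3) by simp
    ultimately show ?thesis by simp
  qed
  then have "AE \<omega> in M. real_cond_exp M (gen_sigma M X I) (indicator {\<omega> \<in> space M. X s \<omega> = b}) \<omega>
      = indicator {\<omega> \<in> space M. X s \<omega> = b} \<omega>"
    by (intro F.real_cond_exp_F_meas) (auto simp: emeasure_eq_measure)
  moreover have "AE \<omega> in M. indicat_real {\<omega> \<in> space M. X t \<omega> = b} \<omega> = indicator {\<omega> \<in> space M. X s \<omega> = b} \<omega>"
    using assms(1) unfolding constant_process_def
  proof eventually_elim
    case (elim \<omega>)
    have "1 \<le> s" using assms(2,3) by auto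
    then have "X t \<omega> = X s \<omega>"
      using elim[rule_format, of t] elim[rule_format, of s] assms(4) by simp
    then show ?case by (simp add: indicator_def)
  qed
  then have "AE \<omega> in M. real_cond_exp M (gen_sigma M X I) (indicator {\<omega> \<in> space M. X t \<omega> = b}) \<omega>
      = real_cond_exp M (gen_sigma M X I) (indicator {\<omega> \<in> space M. X s \<omega> = b}) \<omega>"
    by (rule F.real_cond_exp_cong) auto
  ultimately show ?thesis
    unfolding cond_prob_given_def by eventually_elim simp
qed

text \<open>By independence the constant \<open>prob\<close> has the right integral over every event
  generated by the \<open>X i\<close> with \<open>i \<in> I\<close>, which characterizes the
  conditional expectation.\<close>

lemma cond_prob_if_iid:
  assumes "iid M X" "I \<subseteq> {1..}" "t \<notin> I" "1 \<le> t"
  shows "AE \<omega> in M. cond_prob_given M X I t b \<omega> = prob {\<omega> \<in> space M. X 1 \<omega> = b}"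
proof -
  interpret F: finite_measure_subalgebra M "gen_sigma M X I"
    using assms(2) by (rule gen_sigma_subalgebra)
  let ?E = "{\<omega> \<in> space M. X t \<omega> = b}" and ?f = "\<lambda>\<omega>. \<lambda>i\<in>I. X i \<omega>"
  have [measurable]: "?E \<in> events" using assms(4) by auto
  \<comment> \<open>The single variable \<open>X t\<close> is treated as a block indexed by
    \<open>{t}\<close>, so that independence of disjoint blocks applies.\<close>
  have indep: "indep_var (seq_space I) ?f (seq_space {t}) (\<lambda>\<omega>. \<lambda>i\<in>{t}. X i \<omega>)"
    unfolding seq_space_def
    using assms by (intro indep_var_restrict[of _ _ "{1..}"]) (auto simp: iid_def)
  have same: "prob ?E = prob {\<omega> \<in> space M. X 1 \<omega> = b}"
    using assms(1,4) unfolding iid_def by (intro prob_eq_if_distr_eq) blast+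
  have int: "(LINT \<omega>:A|M. indicat_real ?E \<omega>) = (LINT \<omega>:A|M. prob ?E)"
    if A: "A \<in> sets (gen_sigma M X I)" for A
  proof -
    have "?f \<in> space M \<rightarrow> space (seq_space I)" by (auto simp: seq_space_def space_PiM)
    with A obtain B where B: "B \<in> sets (seq_space I)" "A = ?f -` B \<inter> space M"
      unfolding gen_sigma_def by (auto simp: sets_vimage_algebra2)
    have [measurable]: "A \<in> events"
      using A F.subalg unfolding subalgebra_def by blast
    have E: "(\<lambda>\<omega>. \<lambda>i\<in>{t}. X i \<omega>) -` {\<lambda>i\<in>{t}. b} \<inter> space M = ?E"
      by (auto simp: fun_eq_iff restrict_def split: if_splits)
    have "A \<inter> ?E = (\<lambda>\<omega>. (?f \<omega>, \<lambda>i\<in>{t}. X i \<omega>)) -` (B \<times> {\<lambda>i\<in>{t}. b}) \<inter> space M"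
      unfolding B(2) E[symmetric] by auto
    also have "prob \<dots> = prob A * prob ?E"
      unfolding B(2) E[symmetric] using B(1)
      by (intro indep_varD[OF indep]) (auto simp: seq_space_finite)
    finally have "prob (A \<inter> ?E) = prob A * prob ?E" .
    then show ?thesis
      by (simp add: set_lebesgue_integral_def indicator_inter_arith[symmetric])
  qed
  show ?thesis
    unfolding cond_prob_given_def same[symmetric]
    by (rule F.real_cond_exp_charact[OF int]) (auto simp: emeasure_eq_measure)
qed

text \<open>Both conditional probabilities equal the same explicit function: the indicator of
  \<open>X (t - 1) = b\<close>, or the marginal probability. By \<open>1 \<le> k\<close> the time
  \<open>t - 1\<close> belongs to the window.\<close>

lemma markov_if_constant_or_iid:
  assumes "constant_process M X \<or> iid M X" "1 \<le> k"
  shows "markov_of_order k M X"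
  unfolding markov_of_order_def
proof (intro allI impI)
  fix t b assume "k < t"
  from assms(1) show "AE \<omega> in M. cond_prob_given M X {1..t - 1} t b \<omega> =
      cond_prob_given M X {t - k..t - 1} t b \<omega>"
  proof
    assume const: "constant_process M X"
    show ?thesis
      using cond_prob_if_constant[OF const, of "{1..t - 1}" "t - 1" t b]
        cond_prob_if_constant[OF const, of "{t - k..t - 1}" "t - 1" t b] \<open>k < t\<close> \<open>1 \<le> k\<close>
      by fastforce
  next
    assume iid: "iid M X"
    show ?thesis
      using cond_prob_if_iid[OF iid, of "{1..t - 1}" t b]
        cond_prob_if_iid[OF iid, of "{t - k..t - 1}" t b] \<open>k < t\<close>
      by fastforce
  qed
qed

text \<open>The kernel is the point mass at the last letter in the constant case and a fixed
  Bernoulli law in the i.i.d. case.\<close>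

lemma homogeneous_markov_if_constant_or_iid:
  assumes "constant_process M X \<or> iid M X" "1 \<le> k"
  shows "homogeneous_markov_of_order k M X"
  using assms(1)
proof
  assume const: "constant_process M X"
  have "AE \<omega> in M. cond_prob_given M X {1..t - 1} t b \<omega> =
      pmf (return_pmf (last (map (\<lambda>i. X i \<omega>) [t - k..<t]))) b" if "k < t" for t b
  proof -
    have "last (map (\<lambda>i. X i \<omega>) [t - k..<t]) = X (t - 1) \<omega>" for \<omega>
    proof -
      have "t - k < t" using that \<open>1 \<le> k\<close> by simp
      then show ?thesis by (simp add: last_map)
    qed
    moreover have "AE \<omega> in M. cond_prob_given M X {1..t - 1} t b \<omega> =
        indicator {\<omega> \<in> space M. X (t - 1) \<omega> = b} \<omega>"
      using that \<open>1 \<le> k\<close> by (intro cond_prob_if_constant const) auto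
    ultimately show ?thesis
      using AE_space by (auto simp: indicator_def elim!: eventually_elim2)
  qed
  then show ?thesis
    unfolding homogeneous_markov_of_order_def by (intro exI[of _ "\<lambda>u. return_pmf (last u)"]) blast
next
  assume iid: "iid M X"
  let ?K = "bernoulli_pmf (prob {\<omega> \<in> space M. X 1 \<omega> = True})"
  have "prob {\<omega> \<in> space M. X 1 \<omega> = b} = pmf ?K b" for b
    by (rule prob_eq_pmf_bernoulli) simp
  then have "AE \<omega> in M. cond_prob_given M X {1..t - 1} t b \<omega> = pmf ?K b" if "k < t" for t b
    using cond_prob_if_iid[OF iid, of "{1..t - 1}" t b] that by auto
  then show ?thesis
    unfolding homogeneous_markov_of_order_def by (intro exI[of _ "\<lambda>_. ?K"]) blast
qed

section \<open>Bernoulli marginals and the equivalences for processes\<close>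

lemma distr_bernoulli:
  assumes "1 \<le> t"
  shows "distr M (count_space UNIV) (X t) = measure_pmf (bernoulli_pmf (prob {\<omega> \<in> space M. X t \<omega> = True}))"
proof (rule measure_eqI_countable[of _ UNIV])
  fix b
  note prob_eq_pmf_bernoulli[OF assms, of b]
  moreover have "X t -` {b} \<inter> space M = {\<omega> \<in> space M. X t \<omega> = b}" by auto
  ultimately show "emeasure (distr M (count_space UNIV) (X t)) {b} =
      emeasure (measure_pmf (bernoulli_pmf (prob {\<omega> \<in> space M. X t \<omega> = True}))) {b}"
    using assms by (simp add: emeasure_distr meas emeasure_eq_measure emeasure_pmf_single)
qed auto

text \<open>From right to left, the order \<open>k = 1\<close> serves as witness.\<close>

lemma exchangeable_markov_iff:
  "(\<exists>k\<ge>1. markov_of_order k M X) \<and> exchangeable M X \<longleftrightarrow> constant_process M X \<or> iid M X"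
  using word_markov_if_markov constant_or_iid markov_if_constant_or_iid
    exchangeable_if_constant exchangeable_if_iid by (meson order_refl)

lemma exchangeable_homogeneous_markov_iff:
  assumes "1 \<le> k"
  shows "homogeneous_markov_of_order k M X \<and> exchangeable M X \<longleftrightarrow> constant_process M X \<or> iid M X"
  using word_markov_if_homogeneous_markov constant_or_iid exchangeable_if_constant exchangeable_if_iid
    homogeneous_markov_if_constant_or_iid[OF _ assms] by blast

end

section \<open>Laws on sequence space\<close>

lemma binary_sequence_coord:
  assumes "P \<in> laws"
  shows "binary_sequence P coord"
proof -
  have "coord t \<in> measurable P (count_space UNIV)" if "1 \<le> t" for t
  proof -
    have "(\<lambda>x. x t) \<in> measurable (\<Pi>\<^sub>M i\<in>{1..}. count_space UNIV) (count_space UNIV)"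
      using that by (intro measurable_component_singleton) auto
    moreover have "measurable P (count_space UNIV) =
        measurable (\<Pi>\<^sub>M i\<in>{1..}. count_space UNIV) (count_space (UNIV :: bool set))"
      using assms by (intro measurable_cong_sets) (simp_all add: laws_def seq_space_def)
    ultimately have "(\<lambda>x. x t) \<in> measurable P (count_space UNIV)" by simp
    then show ?thesis by (simp add: coord_def[abs_def])
  qed
  then show ?thesis
    using assms by (simp add: binary_sequence_def binary_sequence_axioms_def laws_def)
qed

text \<open>Points of the sequence space are extensional on \<open>{1..}\<close>, so the vector of
  all coordinates is the identity. This identifies \<open>P\<close> with the joint law of its
  coordinate process.\<close>

lemma distr_coord:
  assumes "P \<in> laws"
  shows "distr P (\<Pi>\<^sub>M i\<in>{1..}. count_space UNIV) (\<lambda>x. \<lambda>i\<in>{1..}. coord i x) = P"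
proof -
  have sets: "sets P = sets (\<Pi>\<^sub>M i\<in>{1::nat..}. count_space (UNIV :: bool set))"
    using assms by (simp add: laws_def seq_space_def)
  then have "space P = (\<Pi>\<^sub>E i\<in>{1..}. UNIV)"
    using sets_eq_imp_space_eq[OF sets] by (simp add: space_PiM)
  then have "(\<lambda>i\<in>{1..}. coord i x) = x" if "x \<in> space P" for x
    using that by (simp add: coord_def PiE_def extensional_restrict)
  then have "distr P (\<Pi>\<^sub>M i\<in>{1..}. count_space UNIV) (\<lambda>x. \<lambda>i\<in>{1..}. coord i x)
      = distr P (\<Pi>\<^sub>M i\<in>{1..}. count_space UNIV) (\<lambda>x. x)"
    by (intro distr_cong) auto
  also have "\<dots> = P" using sets by (rule distr_id2[OF sym])
  finally show ?thesis .
qed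

text \<open>By \<open>distr_coord\<close>, independence of the coordinates says that
  \<open>P\<close> is the product of its marginals; a common marginal on \<open>bool\<close> is a
  Bernoulli law.\<close>

lemma iid_coord_iff:
  assumes "P \<in> laws"
  shows "iid P coord \<longleftrightarrow> P \<in> iid_bernoulli_laws"
proof -
  interpret binary_sequence P coord using assms by (rule binary_sequence_coord)
  have indep: "indep_vars (\<lambda>_. count_space UNIV) coord {1..} \<longleftrightarrow>
      P = (\<Pi>\<^sub>M i\<in>{1..}. distr P (count_space UNIV) (coord i))"
    using indep_vars_iff_distr_eq_PiM'[of "{1..}" coord "\<lambda>_. count_space UNIV"]
    unfolding distr_coord[OF assms] by (auto simp: meas)
  show ?thesis
  proof
    assume iid: "iid P coord"
    let ?p = "prob {\<omega> \<in> space P. coord 1 \<omega> = True}"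
    have "(\<Pi>\<^sub>M i\<in>{1..}. distr P (count_space UNIV) (coord i)) = (\<Pi>\<^sub>M i\<in>{1::nat..}. measure_pmf (bernoulli_pmf ?p))"
    proof (rule PiM_cong[OF refl])
      fix i :: nat assume "i \<in> {1..}"
      then have "distr P (count_space UNIV) (coord i) = distr P (count_space UNIV) (coord 1)"
        using iid unfolding iid_def by blast
      then show "distr P (count_space UNIV) (coord i) = measure_pmf (bernoulli_pmf ?p)"
        using distr_bernoulli[of 1] by simp
    qed
    moreover have "P = (\<Pi>\<^sub>M i\<in>{1..}. distr P (count_space UNIV) (coord i))"
      using iid indep unfolding iid_def by blast
    ultimately have "P = (\<Pi>\<^sub>M i\<in>{1..}. measure_pmf (bernoulli_pmf ?p))" by (rule trans[rotated])
    moreover have "?p \<in> {0..1}" by simp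
    ultimately show "P \<in> iid_bernoulli_laws" unfolding iid_bernoulli_laws_def by blast
  next
    assume "P \<in> iid_bernoulli_laws"
    then obtain p where P: "P = (\<Pi>\<^sub>M i\<in>{1..}. measure_pmf (bernoulli_pmf p))"
      unfolding iid_bernoulli_laws_def by blast
    have marginal: "distr P (count_space UNIV) (coord i) = measure_pmf (bernoulli_pmf p)" if "1 \<le> i" for i
    proof -
      have "distr P (count_space UNIV) (coord i) = distr P (measure_pmf (bernoulli_pmf p)) (\<lambda>x. x i)"
        by (intro distr_cong) (auto simp: coord_def)
      also have "\<dots> = measure_pmf (bernoulli_pmf p)"
        unfolding P using that by (intro distr_PiM_component) (auto intro: measure_pmf.prob_space_axioms)
      finally show ?thesis .
    qed
    have "P = (\<Pi>\<^sub>M i\<in>{1..}. distr P (count_space UNIV) (coord i))"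
      by (subst P, rule PiM_cong) (auto simp: marginal)
    then show "iid P coord"
      unfolding iid_def using indep marginal by simp
  qed
qed

lemma iid_bernoulli_laws_subset: "iid_bernoulli_laws \<subseteq> laws"
  unfolding iid_bernoulli_laws_def laws_def seq_space_def
  by (auto intro!: prob_space_PiM sets_PiM_cong measure_pmf.prob_space_axioms)

text \<open>The first marginal is a law on \<open>bool\<close>, hence Bernoulli with parameter the
  probability of \<open>True\<close>.\<close>

lemma constant_laws_eq: "constant_laws = {P \<in> laws. constant_process P coord}"
proof -
  have "\<exists>p\<in>{0..1}. distr P (count_space UNIV) (coord 1) = measure_pmf (bernoulli_pmf p)"
    if "P \<in> laws" for P
  proof -
    interpret binary_sequence P coord using that by (rule binary_sequence_coord)
    show ?thesis
      using distr_bernoulli[of 1] by (intro bexI[of _ "prob {\<omega> \<in> space P. coord 1 \<omega> = True}"]) auto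
  qed
  then show ?thesis unfolding constant_laws_def by blast
qed

theorem proposition4:
  fixes M :: "'a measure" and X :: "nat \<Rightarrow> 'a \<Rightarrow> bool"
  assumes "binary_process M X"
  shows "((\<exists>k\<ge>1. markov_of_order k M X) \<and> exchangeable M X \<longleftrightarrow> constant_process M X \<or> iid M X)
       \<and> ((\<exists>k\<ge>1. homogeneous_markov_of_order k M X) \<and> exchangeable M X \<longleftrightarrow> constant_process M X \<or> iid M X)
       \<and> (\<forall>k\<ge>1. exchangeable_laws \<inter> markov_laws k = iid_bernoulli_laws \<union> constant_laws)"
proof -
  interpret binary_sequence M X
    using assms by (simp add: binary_process_def binary_sequence_def binary_sequence_axioms_def)
  have "exchangeable_laws \<inter> markov_laws k = iid_bernoulli_laws \<union> constant_laws" if "1 \<le> k" for k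
  proof -
    \<comment> \<open>The equivalence for processes is applied to the coordinate process under each
      law \<open>P\<close>, not to the given \<open>X\<close>.\<close>
    have "homogeneous_markov_of_order k P coord \<and> exchangeable P coord \<longleftrightarrow>
        P \<in> constant_laws \<or> P \<in> iid_bernoulli_laws" if "P \<in> laws" for P
      using binary_sequence.exchangeable_homogeneous_markov_iff[OF binary_sequence_coord[OF that] \<open>1 \<le> k\<close>]
        iid_coord_iff[OF that] that by (simp add: constant_laws_eq)
    then show ?thesis
      using iid_bernoulli_laws_subset
      unfolding exchangeable_laws_def markov_laws_def constant_laws_eq by blast
  qed
  then show ?thesis
    using exchangeable_markov_iff exchangeable_homogeneous_markov_iff by blast
qed

end
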